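(* Let $n\ge 8$ be an integer and define $g(n)=2n-\lfloor n/4\rfloor$ if $n\equiv 0$ or $3 \pmod 4$, and $g(n)=2n+1-\lfloor n/4\rfloor$ otherwise. Then the minimum number of edges of a $2$-connected locally nonforesty graph of order $n$ is $g(n)$; that is, every $2$-connected locally nonforesty graph of order $n$ has at least $g(n)$ edges, and there exists a $2$-connected locally nonforesty graph of order $n$ with exactly $g(n)$ edges.
   Context: All graphs are finite and simple. The order of a graph is its number of vertices and its size is its number of edges. For a vertex $v$ of a graph $G$, the local subgraph at $v$ is the subgraph of $G$ induced by the (open) neighborhood $N(v)$ of $v$. A graph $G$ is called locally nonforesty if every local subgraph of $G$ contains a cycle (equivalently, every vertex of $G$ is the hub of a wheel in $G$). *)

theory Defs
  imports "Graph_Theory.Graph_Theory"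
begin

text \<open>
  A finite simple graph is represented by the locale \<^locale>\<open>pair_graph\<close>: a finite vertex set with
  a symmetric irreflexive adjacency relation. An undirected edge is therefore a pair of opposite
  arcs, and the size of a graph has to count unordered pairs rather than arcs.
\<close>

definition graph_order :: "('a, 'b) pre_digraph \<Rightarrow> nat" where
  "graph_order G = card (verts G)"

definition graph_edges :: "('a, 'b) pre_digraph \<Rightarrow> 'a set set" where
  "graph_edges G = {{u, v} | u v. u \<rightarrow>\<^bsub>G\<^esub> v}"

definition graph_size :: "('a, 'b) pre_digraph \<Rightarrow> nat" where
  "graph_size G = card (graph_edges G)"

definition neighborhood :: "('a, 'b) pre_digraph \<Rightarrow> 'a \<Rightarrow> 'a set" where
  "neighborhood G v = {u \<in> verts G. v \<rightarrow>\<^bsub>G\<^esub> u}"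

definition local_subgraph :: "('a, 'b) pre_digraph \<Rightarrow> 'a \<Rightarrow> ('a, 'b) pre_digraph" where
  "local_subgraph G v = G \<restriction> neighborhood G v"

text \<open>
  In a symmetric digraph, going back and forth along an edge is a \<^const>\<open>pre_digraph.cycle\<close>
  of length 2 (so \<^const>\<open>forest\<close> only holds for edgeless graphs). In a simple graph, cycles have
  length at least 3.
\<close>

definition contains_cycle :: "('a, 'b) pre_digraph \<Rightarrow> bool" where
  "contains_cycle G \<longleftrightarrow> (\<exists>p. pre_digraph.cycle G p \<and> 3 \<le> length p)"

definition locally_nonforesty :: "('a, 'b) pre_digraph \<Rightarrow> bool" where
  "locally_nonforesty G \<longleftrightarrow> (\<forall>v \<in> verts G. contains_cycle (local_subgraph G v))"

definition k_connected :: "nat \<Rightarrow> ('a, 'b) pre_digraph \<Rightarrow> bool" where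
  "k_connected k G \<longleftrightarrow> k < graph_order G \<and>
     (\<forall>S \<subseteq> verts G. card S < k \<longrightarrow> connected (G \<restriction> (verts G - S)))"

definition g_bound :: "nat \<Rightarrow> nat" where
  "g_bound n = (if n mod 4 = 0 \<or> n mod 4 = 3 then 2 * n - n div 4 else 2 * n + 1 - n div 4)"

end

theory Submission
  imports Defs
begin

text \<open>
  Lower bound, by discharging. Every vertex \<open>v\<close> has degree at least 3, and if it has degree 3 then
  \<open>v\<close> and its neighbours form a \<open>K\<^sub>4\<close>; by 2-connectedness such a \<open>K\<^sub>4\<close> contains at most two vertices
  of degree 3. Give each vertex the charge \<open>12 deg v - 42\<close>, so that the total charge is
  \<open>24 m - 42 n\<close>, and let each vertex of degree 3 (charge \<open>-6\<close>) collect 6 in equal parts from its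
  neighbours of higher degree. No vertex ends up negative, so \<open>m \<ge> 7 n / 4\<close>. If moreover the total is
  at most 12, then the short list of possible final charges forces, apart from at most one
  exceptional \<open>K\<^sub>4\<close>, every vertex of higher degree to lie in a \<open>K\<^sub>4\<close> with two vertices of degree 3,
  and then \<open>4\<close> divides \<open>n\<close>. In the remaining residue classes \<open>24 m - 42 n > 12\<close> is exactly what is
  needed.

  The bound is attained by a ring of copies of \<open>K\<^sub>4\<close>, the last of which overlaps its predecessor if
  \<open>n\<close> is not a multiple of 4.
\<close>

section \<open>Double counting for symmetric relations\<close>

lemma sum_card_Int_neighbours_swap:
  assumes "finite X" "finite Y" and "\<And>u v. v \<in> N u \<Longrightarrow> u \<in> N v"
  shows "(\<Sum>u\<in>X. card (N u \<inter> Y)) = (\<Sum>v\<in>Y. card (N v \<inter> X))"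
proof -
  have "(\<Sum>u\<in>X. card (N u \<inter> Y)) = (\<Sum>u\<in>X. \<Sum>v\<in>Y. if v \<in> N u then 1 else 0)"
    using assms(2) by (intro sum.cong refl) (simp add: sum.If_cases Int_commute)
  also have "\<dots> = (\<Sum>v\<in>Y. \<Sum>u\<in>X. if u \<in> N v then 1 else 0)"
    by (subst sum.swap, intro sum.cong refl) (auto dest: assms(3))
  also have "\<dots> = (\<Sum>v\<in>Y. card (N v \<inter> X))"
    using assms(1) by (intro sum.cong refl) (simp add: sum.If_cases Int_commute)
  finally show ?thesis .
qed

text \<open>There are no loops, so every edge inside \<open>X\<close> is the image under
  \<open>f\<close> of exactly two arcs; the left-hand side counts the arcs.\<close>

lemma handshake:
  assumes "finite X" and sym: "\<And>u v. v \<in> N u \<Longrightarrow> u \<in> N v" and irrefl: "\<And>u. u \<notin> N u"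
  shows "(\<Sum>u\<in>X. card (N u \<inter> X)) = 2 * card {{u, v} |u v. u \<in> X \<and> v \<in> X \<and> v \<in> N u}"
proof -
  define R where "R = (SIGMA u:X. N u \<inter> X)"
  define f where "f = (\<lambda>(u, v). {u, v :: 'a})"
  have fin: "finite R"
    using \<open>finite X\<close> by (auto simp: R_def)
  have fiber: "card {r \<in> R. f r = e} = 2" if "e \<in> f ` R" for e
  proof -
    obtain r where "r \<in> R" "e = f r"
      using \<open>e \<in> f ` R\<close> by blast
    then obtain u v where uv: "(u, v) \<in> R" "e = {u, v}"
      by (cases r) (simp add: f_def)
    then have "u \<noteq> v" "{r \<in> R. f r = e} = {(u, v), (v, u)}"
      using irrefl by (auto simp: R_def f_def doubleton_eq_iff dest: sym)
    then show ?thesis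
      by simp
  qed
  have "(\<Sum>u\<in>X. card (N u \<inter> X)) = card R"
    using \<open>finite X\<close> by (simp add: R_def card_SigmaI)
  also have "\<dots> = (\<Sum>e\<in>f ` R. card {r \<in> R. f r = e})"
    unfolding card_eq_sum by (rule sum.image_gen[OF fin])
  also have "\<dots> = 2 * card (f ` R)"
    using fiber by simp
  also have "f ` R = {{u, v} |u v. u \<in> X \<and> v \<in> X \<and> v \<in> N u}"
    by (auto simp: R_def f_def image_iff)
  finally show ?thesis .
qed

lemma even_card_if_perfect_matching:
  assumes "finite X" "\<And>u v. v \<in> N u \<Longrightarrow> u \<in> N v" "\<And>u. u \<notin> N u"
    and "\<And>u. u \<in> X \<Longrightarrow> card (N u \<inter> X) = 1"
  shows "even (card X)"
  using handshake[of X N] assms by simp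

section \<open>The discharging argument\<close>

text \<open>\<open>rim\<close> keeps of a cycle in the neighbourhood only its vertex set, in which
  every member has two neighbours. \<open>no_cut\<close> is 2-connectedness in terms of closed sets:
  after the deletion of at most one vertex, no proper nonempty part of the remainder is closed under
  adjacency.\<close>

locale wheel_graph =
  fixes V :: "'a set" and N :: "'a \<Rightarrow> 'a set"
  assumes finite_V: "finite V"
    and N_subset: "N u \<subseteq> V"
    and sym: "v \<in> N u \<Longrightarrow> u \<in> N v"
    and irrefl: "u \<notin> N u"
    and rim: "u \<in> V \<Longrightarrow> \<exists>C \<subseteq> N u. C \<noteq> {} \<and> (\<forall>x\<in>C. 2 \<le> card (N x \<inter> C))"
    and no_cut: "S \<subseteq> V \<Longrightarrow> card S < 2 \<Longrightarrow> X \<subseteq> V - S \<Longrightarrow> X \<noteq> {} \<Longrightarrow>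
      (\<And>x. x \<in> X \<Longrightarrow> N x \<subseteq> X \<union> S) \<Longrightarrow> X = V - S"
    and card_V: "8 \<le> card V"
begin

lemma finite_N [simp]: "finite (N u)"
  using N_subset finite_V finite_subset by blast

lemma card_rim:
  assumes "x \<in> C" "C \<subseteq> N u" "2 \<le> card (N x \<inter> C)"
  shows "3 \<le> card C"
proof -
  have "N x \<inter> C \<subseteq> C - {x}" "finite C"
    using irrefl finite_N assms(2) by (auto intro: finite_subset)
  then have "card (N x \<inter> C) \<le> card C - 1"
    using card_mono[of "C - {x}" "N x \<inter> C"] \<open>x \<in> C\<close> by simp
  then show ?thesis
    using assms(3) by linarith
qed

lemma degree_ge_3: "u \<in> V \<Longrightarrow> 3 \<le> card (N u)"
  using rim[of u] card_rim card_mono[OF finite_N] by (metis all_not_in_conv le_trans)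

section \<open>Structure around vertices of degree 3\<close>

definition cubic :: "'a set" where
  "cubic = {v \<in> V. card (N v) = 3}"

text \<open>By \<open>at_most_one_cubic_neighbour\<close> the cubic neighbour is unique, so these
  vertices come in adjacent pairs.\<close>

definition twinned :: "'a set" where
  "twinned = {v \<in> cubic. N v \<inter> cubic \<noteq> {}}"

definition lonely :: "'a set" where
  "lonely = {v \<in> cubic. N v \<inter> cubic = {}}"

definition big :: "'a set" where
  "big = V - cubic"

lemma cubicD: "v \<in> cubic \<Longrightarrow> v \<in> V" "v \<in> cubic \<Longrightarrow> card (N v) = 3"
  by (auto simp: cubic_def)

text \<open>A rim has at least three vertices, so here it is all of \<open>N v\<close>; three
  vertices with two neighbours each among themselves form a triangle. Thus \<open>v\<close> and its
  neighbours form a K4.\<close>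

lemma cubic_neighbours_adjacent:
  assumes "v \<in> cubic" "x \<in> N v" "y \<in> N v" "x \<noteq> y"
  shows "y \<in> N x"
proof -
  obtain C where C: "C \<subseteq> N v" "C \<noteq> {}" "\<And>x. x \<in> C \<Longrightarrow> 2 \<le> card (N x \<inter> C)"
    using rim cubicD(1) assms(1) by metis
  then have "3 \<le> card C"
    using card_rim by blast
  then have "C = N v"
    using C(1) cubicD(2)[OF assms(1)] by (simp add: card_seteq)
  then have "2 \<le> card (N x \<inter> N v)" "N x \<inter> N v \<subseteq> N v - {x}" "card (N v - {x}) = 2"
    using C assms irrefl cubicD by auto
  then have "N x \<inter> N v = N v - {x}"
    by (intro card_seteq) auto
  then show ?thesis
    using assms by blast
qed

lemma cubic_adjacent_eq:
  assumes "v \<in> cubic" "w \<in> cubic" "w \<in> N v"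
  shows "insert w (N w) = insert v (N v)"
proof -
  have "insert v (N v) \<subseteq> insert w (N w)"
    using assms cubic_neighbours_adjacent sym by blast
  moreover have "card (insert w (N w)) = 4" "card (insert v (N v)) = 4"
    using assms cubicD irrefl by simp_all
  ultimately show ?thesis
    by (metis card_subset_eq finite_N finite_insert)
qed

text \<open>By connectedness such a set is all of \<open>V\<close>. It serves to refute
  configurations that would form a small component.\<close>

lemma card_closed_ge_8:
  assumes "X \<subseteq> V" "X \<noteq> {}" "\<And>x. x \<in> X \<Longrightarrow> N x \<subseteq> X"
  shows "8 \<le> card X"
  using no_cut[of "{}" X] assms card_V by simp

text \<open>Two cubic neighbours \<open>x\<close> and \<open>y\<close> would have the same closed
  neighbourhood as \<open>v\<close>. Then the fourth vertex \<open>z\<close> of this K4 would cut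
  \<open>{v, x, y}\<close> off from the rest of the graph.\<close>

lemma at_most_one_cubic_neighbour:
  assumes "v \<in> cubic"
  shows "card (N v \<inter> cubic) \<le> 1"
proof (rule ccontr)
  assume "\<not> ?thesis"
  then obtain x y where xy: "x \<in> N v \<inter> cubic" "y \<in> N v \<inter> cubic" "x \<noteq> y"
    by (metis One_nat_def card_le_Suc0_iff_eq finite_Int finite_N)
  then have "card (N v - {x, y}) = 1"
    using assms cubicD(2) by (simp add: card_Diff_subset)
  then obtain z where "N v - {x, y} = {z}"
    by (auto simp: card_1_singleton_iff)
  then have z: "N v = {x, y, z}" "z \<noteq> x" "z \<noteq> y"
    using xy by auto
  then have "z \<noteq> v" "x \<noteq> v" "y \<noteq> v"
    using irrefl[of v] by auto
  have "N x \<subseteq> insert v (N v)" "N y \<subseteq> insert v (N v)"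
    using cubic_adjacent_eq[of v x] cubic_adjacent_eq[of v y] assms xy by blast+
  moreover have "z \<in> V"
    using z(1) N_subset by auto
  ultimately have "{v, x, y} = V - {z}"
    using z xy assms cubicD(1) \<open>z \<noteq> v\<close> by (intro no_cut) auto
  then have "V = {v, x, y, z}"
    using \<open>z \<in> V\<close> by auto
  then show False
    using card_V by (simp add: card_insert_if split: if_splits)
qed

lemma cubic_split: "cubic = twinned \<union> lonely" "twinned \<inter> lonely = {}"
  by (auto simp: twinned_def lonely_def)

lemma V_split: "V = big \<union> cubic" "big \<inter> cubic = {}"
  by (auto simp: big_def cubic_def)

lemma finite_parts [simp]: "finite big" "finite cubic" "finite twinned" "finite lonely"
  using finite_V by (auto simp: big_def cubic_def twinned_def lonely_def)

lemma twinned_neighbours: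
  assumes "v \<in> twinned"
  shows "N v \<inter> cubic = N v \<inter> twinned" "card (N v \<inter> twinned) = 1" "card (N v \<inter> big) = 2"
proof -
  have v: "v \<in> cubic" "N v \<inter> cubic \<noteq> {}"
    using assms by (auto simp: twinned_def)
  show *: "N v \<inter> cubic = N v \<inter> twinned"
    using v sym by (auto simp: twinned_def)
  show "card (N v \<inter> twinned) = 1"
    using at_most_one_cubic_neighbour[OF v(1)] v(2) card_0_eq[of "N v \<inter> cubic"]
    unfolding * by fastforce
  moreover have "card (N v) = card (N v \<inter> big) + card (N v \<inter> cubic)"
    using N_subset[of v] V_split
    by (subst card_Un_disjoint[symmetric]) (auto intro: arg_cong[where f=card])
  ultimately show "card (N v \<inter> big) = 2"
    using cubicD(2)[OF v(1)] * by simp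
qed

lemma lonely_neighbours:
  assumes "v \<in> lonely"
  shows "N v \<subseteq> big" "card (N v) = 3"
  using assms N_subset by (auto simp: lonely_def big_def cubic_def)

section \<open>Cubic neighbours of a vertex of higher degree\<close>

abbreviation tw :: "'a \<Rightarrow> nat" where
  "tw u \<equiv> card (N u \<inter> twinned)"

abbreviation lo :: "'a \<Rightarrow> nat" where
  "lo u \<equiv> card (N u \<inter> lonely)"

lemma degree_split: "card (N u) = tw u + lo u + card (N u \<inter> big)"
proof -
  have "N u = N u \<inter> twinned \<union> N u \<inter> lonely \<union> N u \<inter> big"
    using N_subset[of u] V_split cubic_split by auto
  moreover have "card (N u \<inter> twinned \<union> N u \<inter> lonely \<union> N u \<inter> big) =
      tw u + lo u + card (N u \<inter> big)"
    using V_split cubic_split by (subst card_Un_disjoint; (subst card_Un_disjoint)?; auto)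
  ultimately show ?thesis
    by metis
qed

lemma sum_tw: "(\<Sum>u\<in>big. tw u) = 2 * card twinned"
  using sum_card_Int_neighbours_swap[of big twinned N] sym twinned_neighbours by simp

lemma sum_lo: "(\<Sum>u\<in>big. lo u) = 3 * card lonely"
proof -
  have "N v \<inter> big = N v" if "v \<in> lonely" for v
    using lonely_neighbours[OF that] by auto
  then show ?thesis
    using sum_card_Int_neighbours_swap[of big lonely N] sym lonely_neighbours by simp
qed

lemma even_card_twinned: "even (card twinned)"
  using even_card_if_perfect_matching[of twinned N] sym irrefl twinned_neighbours by simp

lemma twin_of_neighbour:
  assumes "v \<in> N u \<inter> twinned" "u \<in> big" "w \<in> N v \<inter> twinned"
  shows "w \<in> N u"
  using assms cubic_neighbours_adjacent[of v u w] sym V_split cubic_split by blast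

text \<open>The partner of a twinned neighbour of \<open>u\<close> lies in the same K4 and is again
  a neighbour of \<open>u\<close>, so adjacency matches the twinned neighbours in pairs.\<close>

lemma even_tw:
  assumes "u \<in> big"
  shows "even (tw u)"
proof (rule even_card_if_perfect_matching[of _ N])
  fix v assume v: "v \<in> N u \<inter> twinned"
  then have "N v \<inter> (N u \<inter> twinned) = N v \<inter> twinned"
    using twin_of_neighbour assms by blast
  then show "card (N v \<inter> (N u \<inter> twinned)) = 1"
    using v twinned_neighbours by simp
qed (use sym irrefl in auto)

text \<open>The K4 around a twinned neighbour contains, besides \<open>u\<close>, a second vertex of
  \<open>big\<close>.\<close>

lemma card_Int_big_if_tw:
  assumes "u \<in> big" "0 < tw u"
  shows "1 \<le> card (N u \<inter> big)"
proof -
  obtain v where v: "v \<in> N u" "v \<in> twinned"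
    using assms(2) by (auto simp: card_gt_0_iff)
  have "card (N v \<inter> big - {u}) = 1"
    using twinned_neighbours(3)[OF v(2)] v assms sym by simp
  then obtain y where "y \<in> N v" "y \<in> big" "y \<noteq> u"
    by (auto simp: card_1_singleton_iff)
  then have "y \<in> N u \<inter> big"
    using cubic_neighbours_adjacent[of v u y] v cubic_split sym by blast
  then show ?thesis
    by (metis One_nat_def Suc_leI card_gt_0_iff empty_iff finite_Int finite_N)
qed

lemma lonely_neighbour_clique:
  assumes "v \<in> lonely" "u \<in> N v"
  shows "N v - {u} \<subseteq> N u \<inter> big"
  using cubic_neighbours_adjacent[of v u] assms lonely_neighbours(1)[of v] cubic_split by blast

lemma card_Int_big_if_lo:
  assumes "0 < lo u"
  shows "2 \<le> card (N u \<inter> big)"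
proof -
  obtain v where v: "v \<in> N u" "v \<in> lonely"
    using assms by (auto simp: card_gt_0_iff)
  have "card (N v - {u}) = 2"
    using lonely_neighbours(2)[OF v(2)] v sym by simp
  then show ?thesis
    using lonely_neighbour_clique[of v u] v sym card_mono[of "N u \<inter> big" "N v - {u}"] by simp
qed

text \<open>
  A vertex of degree 3 with a neighbour of degree 3 has two neighbours in \<open>big\<close>, each of which pays it
  \<open>6 / 2\<close>; otherwise it has three, each of which pays \<open>6 / 3\<close>.
\<close>
definition surplus :: "'a \<Rightarrow> int" where
  "surplus u = 12 * int (card (N u)) - 42 - 3 * int (tw u) - 2 * int (lo u)"

text \<open>Discharging preserves the total: a twinned vertex receives 3 from each of two big
  neighbours and a lonely one 2 from each of three, which cancels its charge of
  \<open>12 * 3 - 42 = -6\<close>.\<close>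

lemma sum_surplus: "(\<Sum>u\<in>big. surplus u) = (\<Sum>u\<in>V. 12 * int (card (N u)) - 42)"
proof -
  have c: "card cubic = card twinned + card lonely"
    using cubic_split by (metis card_Un_disjoint finite_parts(3,4))
  have "(\<Sum>u\<in>V. 12 * int (card (N u)) - 42) = (\<Sum>u\<in>big. 12 * int (card (N u)) - 42) +
      (\<Sum>u\<in>cubic. 12 * int (card (N u)) - 42)"
    using V_split by (metis (no_types, lifting) finite_parts(1,2) sum.union_disjoint)
  also have "(\<Sum>u\<in>cubic. 12 * int (card (N u)) - 42) = - 6 * int (card cubic)"
    using cubicD(2) by simp
  finally have "(\<Sum>u\<in>V. 12 * int (card (N u)) - 42) =
      (\<Sum>u\<in>big. 12 * int (card (N u)) - 42) - 6 * int (card cubic)"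
    by simp
  moreover have "(\<Sum>u\<in>big. surplus u) = (\<Sum>u\<in>big. 12 * int (card (N u)) - 42) -
      3 * int (\<Sum>u\<in>big. tw u) - 2 * int (\<Sum>u\<in>big. lo u)"
    by (simp add: surplus_def sum_subtractf sum_distrib_left)
  ultimately show ?thesis
    using c sum_tw sum_lo by simp
qed

lemma degree_big: "u \<in> big \<Longrightarrow> 4 \<le> card (N u)"
  using degree_ge_3[of u] by (fastforce simp: big_def cubic_def)

text \<open>Few combinations survive the parity of \<open>tw u\<close> and the lower bounds on the
  number of big neighbours. The bounds 18 and 15 in \<open>large\<close> are recorded because they
  exceed 12, the limit on the total in the case of equality.\<close>

lemma surplus_cases:
  assumes "u \<in> big"
  obtains
    (perfect) "card (N u) = 4" "tw u = 2" "lo u = 0" "surplus u = 0"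
  | (free) "card (N u) = 4" "tw u = 0" "lo u = 0" "surplus u = 6"
  | (single) "card (N u) = 4" "tw u = 0" "lo u = 1" "surplus u = 4"
  | (double) "card (N u) = 4" "tw u = 0" "lo u = 2" "surplus u = 2"
  | (five) "card (N u) = 5" "tw u = 2 \<or> tw u = 4 \<and> card (N u \<inter> big) = 1" "lo u = 0" "surplus u \<ge> 6"
  | (large) "surplus u \<ge> 10" "card (N u) = 5 \<Longrightarrow> lo u = 0 \<Longrightarrow> surplus u \<ge> 18"
     "card (N u) \<ge> 6 \<Longrightarrow> surplus u \<ge> 15"
proof -
  define D t b c where "D = card (N u)" and "t = tw u" and "b = lo u" and "c = card (N u \<inter> big)"
  note defs = D_def[symmetric] t_def[symmetric] b_def[symmetric] c_def[symmetric]
  have D: "D = t + b + c" "4 \<le> D" and c: "0 < t \<Longrightarrow> 1 \<le> c" "0 < b \<Longrightarrow> 2 \<le> c"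
    and S: "surplus u = 12 * int D - 42 - 3 * int t - 2 * int b"
    using degree_split[of u] degree_big[OF assms] card_Int_big_if_tw[OF assms]
      card_Int_big_if_lo[of u] surplus_def[of u] unfolding defs by blast+
  obtain k where k: "t = 2 * k"
    using even_tw[OF assms] unfolding defs by (rule evenE)
  have b: "b = 0 \<or> b + 2 * k + 2 \<le> D" and t: "k = 0 \<or> b + 2 * k + 1 \<le> D"
    using D c k by linarith+
  consider "D = 4" | "D = 5" | "6 \<le> D"
    using D(2) by linarith
  then show ?thesis
  proof cases
    case 1
    then have "k = 1 \<and> b = 0 \<or> k = 0 \<and> (b = 0 \<or> b = 1 \<or> b = 2)"
      using b t by linarith
    then show ?thesis
      using perfect free single double S 1 k unfolding defs by auto
  next
    case 2
    then have "b = 0 \<and> (k = 0 \<or> k = 1 \<or> k = 2) \<or> 0 < b \<and> b + 2 * k \<le> 3"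
      using b t by linarith
    then consider "b = 0" "k = 1 \<or> k = 2" | "k = 0" "b = 0" | "0 < b" "b + 2 * k \<le> 3"
      by blast
    then show ?thesis
    proof cases
      case 1
      then have "t = 2 \<or> t = 4 \<and> c = 1"
        using D k 2 c by auto
      then show ?thesis
        using five S 1 2 k unfolding defs by auto
    qed (use S 2 k in \<open>auto intro!: large simp: defs\<close>)
  next
    case 3
    then have "t + b + 1 \<le> D"
      using D c by linarith
    \<comment> \<open>Each cubic neighbour costs at most 3, so the surplus is at least
      \<open>12 * D - 42 - 3 * (D - 1) = 9 * D - 39\<close>.\<close>
    then have "15 \<le> surplus u"
      using S 3 by linarith
    then show ?thesis
      using 3 by (intro large) (auto simp: defs)
  qed
qed

lemma surplus_nonneg: "u \<in> big \<Longrightarrow> 0 \<le> surplus u"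
  by (erule surplus_cases) auto

section \<open>Graphs with total surplus at most 12\<close>

lemma sum_surplus_mono:
  assumes "F \<subseteq> big"
  shows "sum surplus F \<le> sum surplus big"
  using assms surplus_nonneg by (intro sum_mono2) auto

lemma card_V_split: "card V = card big + card twinned + card lonely"
  using V_split cubic_split by (metis add.assoc card_Un_disjoint finite_parts)

text \<open>Only the case \<open>double\<close> has to be excluded. There \<open>x\<close>, its
  lonely neighbours \<open>v\<close>, \<open>v'\<close> and its two big neighbours \<open>P\<close>
  form a K5 without the edge between \<open>v\<close> and \<open>v'\<close>, and the small total
  leaves no room for edges leaving these five vertices.\<close>

lemma surplus_lonely_neighbour:
  assumes small: "sum surplus big \<le> 12" and "v \<in> lonely" "x \<in> N v"
  shows "surplus x = 4 \<and> lo x = 1 \<or> 10 \<le> surplus x"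
proof -
  have x: "x \<in> big" "v \<in> N x"
    using assms lonely_neighbours(1) sym by blast+
  from x(1) show ?thesis
  proof (cases rule: surplus_cases)
    case double
    have "card (N x \<inter> lonely - {v}) = 1"
      using double x assms by simp
    then obtain v' where "N x \<inter> lonely - {v} = {v'}"
      by (auto simp: card_1_singleton_iff)
    then have v': "N x \<inter> lonely = {v, v'}" "v' \<in> lonely" "v' \<in> N x"
      using x assms(2) by auto
    define P where "P = N x \<inter> big"
    have P: "card P = 2" "finite P" "N x \<inter> twinned = {}"
      using double degree_split[of x] by (auto simp: P_def)
    have clique: "N w = insert x P" if "w \<in> {v, v'}" for w
    proof -
      have w: "w \<in> lonely" "x \<in> N w"
        using that assms v' x sym by auto
      then have "N w - {x} = P"
        using lonely_neighbour_clique[OF w] lonely_neighbours(2)[OF w(1)] P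
        by (intro card_subset_eq) (auto simp: P_def)
      then show ?thesis
        using w by auto
    qed
    have Nx: "N x = {v, v'} \<union> P"
      using v'(1) P(3) N_subset[of x] V_split cubic_split unfolding P_def by blast
    have "v \<noteq> v'"
      using v'(1) double by force
    have in_N: "{v, v', x} \<union> (P - {y}) \<subseteq> N y" if "y \<in> P" for y
    proof -
      have "y \<in> N v" "y \<in> N v'" "y \<in> N x"
        using that clique Nx by auto
      moreover have "P - {y} \<subseteq> N y"
        using cubic_neighbours_adjacent[of v y] clique[of v] that assms(2) cubic_split by auto
      ultimately show ?thesis
        using sym by blast
    qed
    have y: "surplus y = 2 \<and> card (N y) = 4 \<or> 10 \<le> surplus y" if "y \<in> P" for y
    proof -
      have "{v, v'} \<subseteq> N y \<inter> lonely"
        using in_N[OF that] assms(2) v' by auto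
      then have "2 \<le> lo y"
        using \<open>v \<noteq> v'\<close> card_mono[of "N y \<inter> lonely" "{v, v'}"] by simp
      moreover have "y \<in> big"
        using that by (auto simp: P_def)
      ultimately show ?thesis
        by (auto elim!: surplus_cases[of y])
    qed
    \<comment> \<open>Otherwise \<open>x\<close>, \<open>y\<close> and the other vertex
      \<open>z\<close> of \<open>P\<close> contribute at least \<open>2 + 10 + 2\<close>, which
      exceeds 12.\<close>
    have small_P: "surplus y = 2" if "y \<in> P" for y
    proof (rule ccontr)
      assume "surplus y \<noteq> 2"
      then have "10 \<le> surplus y"
        using y that by blast
      moreover have "card (P - {y}) = 1"
        using P that by simp
      then obtain z where "P - {y} = {z}"
        by (auto simp: card_1_singleton_iff)
      then have z: "P = {y, z}" "y \<noteq> z"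
        using that by auto
      moreover have "2 \<le> surplus z"
        using y z(1) by fastforce
      moreover have "x \<notin> P" "insert x P \<subseteq> big"
        using irrefl x by (auto simp: P_def)
      ultimately show False
        using sum_surplus_mono[of "insert x P"] small double by auto
    qed
    have "N y \<subseteq> insert x (N x)" if y_in: "y \<in> insert x (N x)" for y
    proof -
      consider "y = x" | "y \<in> {v, v'}" | "y \<in> P"
        using y_in Nx by blast
      then show ?thesis
      proof cases
        case 3
        have "x \<notin> N x" "v \<notin> P" "v' \<notin> P"
          using irrefl assms v' V_split cubic_split by (auto simp: P_def)
        \<comment> \<open>These four neighbours already exhaust the degree 4 of
          \<open>y\<close>.\<close>
        then have "card ({v, v', x} \<union> (P - {y})) = 4"
          using 3 \<open>v \<noteq> v'\<close> P Nx by (subst card_Un_disjoint) auto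
        moreover have "card (N y) = 4"
          using y[OF 3] small_P[OF 3] by auto
        ultimately have "{v, v', x} \<union> (P - {y}) = N y"
          using in_N[OF 3] by (intro card_subset_eq) auto
        then show ?thesis
          using Nx by blast
      qed (use clique Nx in auto)
    qed
    then have "8 \<le> card (insert x (N x))"
      using x V_split N_subset by (intro card_closed_ge_8) auto
    then show ?thesis
      using double(1) by (simp add: card_insert_if split: if_splits)
  qed (use x assms in \<open>auto simp: card_eq_0_iff\<close>)
qed

lemma dvd_card_V_if_lonely:
  assumes small: "sum surplus big \<le> 12" and v: "v \<in> lonely"
  shows "4 dvd card V"
proof -
  note x = surplus_lonely_neighbour[OF small v]
  have Nv: "card (N v) = 3" "N v \<subseteq> big"
    using lonely_neighbours[OF v] by auto
  have le: "sum surplus (N v) \<le> 12"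
    using sum_surplus_mono[OF Nv(2)] small by linarith
  have four: "surplus x = 4" "lo x = 1" if "x \<in> N v" for x
  proof -
    \<comment> \<open>One neighbour of surplus at least 10 and two of surplus at least 4 would give
      18.\<close>
    have "surplus x = 4 \<and> lo x = 1"
    proof (rule ccontr)
      assume "\<not> ?thesis"
      then have "10 \<le> surplus x"
        using x that by blast
      moreover have "int (card (N v - {x})) * 4 \<le> sum surplus (N v - {x})"
        using x by (intro sum_bounded_below) force
      moreover have "card (N v - {x}) = 2"
        using that Nv by simp
      ultimately show False
        using le sum.remove[OF finite_N that, of surplus] by simp
    qed
    then show "surplus x = 4" "lo x = 1"
      by auto
  qed
  then have "sum surplus (N v) = 12"
    using Nv by simp
  \<comment> \<open>The three neighbours of \<open>v\<close> use up the whole total, so all other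
    big vertices are of the kind \<open>perfect\<close>.\<close>
  then have "sum surplus (big - N v) \<le> 0"
    using small sum.subset_diff[OF Nv(2), of surplus] by simp
  moreover have "0 \<le> sum surplus (big - N v)"
    using surplus_nonneg by (intro sum_nonneg) auto
  ultimately have "sum surplus (big - N v) = 0"
    by simp
  then have zero: "surplus u = 0" if "u \<in> big - N v" for u
    using that sum_nonneg_eq_0_iff[of "big - N v" surplus] surplus_nonneg by auto
  then have rest: "tw u = 2 \<and> lo u = 0" if "u \<in> big - N v" for u
  proof -
    have "surplus u = 0" "u \<in> big"
      using zero that by auto
    then show ?thesis
      by (auto elim!: surplus_cases[of u])
  qed
  have "tw x = 0" if "x \<in> N v" for x
  proof -
    have "x \<in> big" "surplus x = 4"
      using four[OF that] that Nv(2) by auto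
    then show ?thesis
      by (auto elim!: surplus_cases[of x])
  qed
  then have "sum tw big = 2 * card (big - N v)"
    using sum.subset_diff[OF Nv(2), of tw] rest by simp
  moreover have "sum lo big = 3"
    using sum.subset_diff[OF Nv(2), of lo] rest four Nv by simp
  moreover have "card (big - N v) + 3 = card big"
    using Nv card_mono[OF finite_parts(1) Nv(2)] by (simp add: card_Diff_subset)
  \<comment> \<open>The sum of \<open>lo\<close> shows that \<open>v\<close> is the only lonely
    vertex, and the sum of \<open>tw\<close> that there are as many twinned vertices as big ones
    outside \<open>N v\<close>. The 4 counts \<open>v\<close> and its neighbours, the exceptional
    K4.\<close>
  ultimately have "card V = 2 * card twinned + 4"
    using card_V_split sum_tw sum_lo by simp
  then show ?thesis
    using even_card_twinned by (auto elim!: evenE)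
qed

text \<open>The four twinned neighbours of \<open>u\<close> share their second big neighbour
  \<open>y\<close>. The small total forces \<open>y\<close> to have degree 5 as well, so
  \<open>u\<close>, \<open>y\<close> and the four twinned vertices would form a component of order
  6.\<close>

lemma tw_neq_4:
  assumes small: "sum surplus big \<le> 12" and u: "u \<in> big" "card (N u) = 5" "tw u = 4"
    and y: "card (N u \<inter> big) = 1"
  shows False
proof -
  obtain y where y: "N u \<inter> big = {y}"
    using y by (auto simp: card_1_singleton_iff)
  define T where "T = N u \<inter> twinned"
  have T: "N v \<inter> big = {u, y}" if "v \<in> T" for v
  proof -
    have v: "v \<in> N u" "v \<in> twinned" "v \<in> cubic" "u \<in> N v"
      using that sym cubic_split by (auto simp: T_def)
    have "card (N v \<inter> big - {u}) = 1"
      using twinned_neighbours(3)[OF v(2)] v u by simp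
    moreover have "N v \<inter> big - {u} \<subseteq> {y}"
      using cubic_neighbours_adjacent[of v u] v y by blast
    ultimately have "N v \<inter> big - {u} = {y}"
      by (intro card_subset_eq) auto
    then show ?thesis
      using v u by auto
  qed
  have "T \<noteq> {}" "finite T" "card T = 4"
    using u(3) by (auto simp: T_def)
  have yN: "y \<in> N u" "u \<in> N y" "y \<in> big" "y \<noteq> u"
    using y sym irrefl by auto
  have sub: "insert u T \<subseteq> N y"
    using T sym yN by blast
  have "u \<notin> T"
    using irrefl by (auto simp: T_def)
  then have card5: "card (insert u T) = 5"
    using \<open>finite T\<close> \<open>card T = 4\<close> by simp
  have "4 \<le> tw y"
    using sub \<open>card T = 4\<close> card_mono[of "N y \<inter> twinned" T] by (auto simp: T_def)
  moreover have "surplus y \<le> 12"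
    using sum_surplus_mono[of "{y}"] yN small by simp
  moreover have "5 \<le> card (N y)"
    using card5 card_mono[OF finite_N sub] by simp
  ultimately have "card (N y) = 5"
    using yN(3) by (auto elim!: surplus_cases[of y])
  then have Ny: "N y = insert u T"
    using card5 card_subset_eq[OF finite_N sub] by simp
  have Nu: "N u = insert y T"
  proof (rule card_subset_eq[symmetric])
    have "y \<notin> T"
      using yN V_split cubic_split by (auto simp: T_def)
    then show "card (insert y T) = card (N u)"
      using \<open>finite T\<close> \<open>card T = 4\<close> u by simp
  qed (use yN in \<open>auto simp: T_def\<close>)
  have "N w \<subseteq> insert u (N u)" if w: "w \<in> insert u (N u)" for w
  proof -
    consider "w = u" | "w = y" | "w \<in> T"
      using w Nu by blast
    then show ?thesis
    proof cases
      case 3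
      then have "N w \<inter> cubic \<subseteq> N u"
        using twin_of_neighbour[of w u] u twinned_neighbours(1)[of w] by (auto simp: T_def)
      then show ?thesis
        using T[OF 3] N_subset[of w] V_split yN by blast
    qed (use Ny Nu in auto)
  qed
  then have "8 \<le> card (insert u (N u))"
    using u V_split N_subset by (intro card_closed_ge_8) auto
  then show False
    using u(2) by (simp add: card_insert_if split: if_splits)
qed

text \<open>It suffices that every big vertex has exactly two twinned neighbours: double counting
  then gives as many big as twinned vertices, and the latter are even in number.\<close>

lemma dvd_card_V_if_no_lonely:
  assumes small: "sum surplus big \<le> 12" and none: "lonely = {}"
  shows "4 dvd card V"
proof -
  have pos: "surplus u = 0 \<and> card (N u) = 4 \<and> tw u = 2 \<or> 6 \<le> surplus u" if "u \<in> big" for u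
    using that none by (auto elim!: surplus_cases[of u])
  have le: "surplus u \<le> 12" if "u \<in> big" for u
    using sum_surplus_mono[of "{u}"] that small by simp
  have "tw u = 2" if u: "u \<in> big" for u
    using u
  proof (cases rule: surplus_cases)
    case free
    have Nu: "N u \<subseteq> big"
      using free none N_subset[of u] V_split cubic_split by auto
    obtain C where C: "C \<subseteq> N u" "C \<noteq> {}" "\<And>x. x \<in> C \<Longrightarrow> 2 \<le> card (N x \<inter> C)"
      using rim[of u] u V_split by blast
    have "3 \<le> card C"
      using C card_rim by blast
    have "finite C"
      using C(1) finite_N by (rule finite_subset)
    have "u \<notin> C"
      using C(1) irrefl by blast
    \<comment> \<open>Otherwise \<open>u\<close> and at least three vertices of \<open>C\<close>
      would have surplus at least 6 each.\<close>
    have "\<exists>x\<in>C. surplus x = 0"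
    proof (rule ccontr)
      assume "\<not> ?thesis"
      then have "int (card (insert u C)) * 6 \<le> sum surplus (insert u C)"
        using pos C(1) Nu free by (intro sum_bounded_below) auto
      moreover have "sum surplus (insert u C) \<le> 12"
        using sum_surplus_mono[of "insert u C"] small C(1) Nu u by force
      ultimately show False
        using \<open>3 \<le> card C\<close> \<open>u \<notin> C\<close> \<open>finite C\<close> by simp
    qed
    then obtain x where x: "x \<in> C" "surplus x = 0"
      by blast
    then have "x \<in> big" "u \<in> N x"
      using C(1) Nu sym by auto
    \<comment> \<open>Two of the four neighbours of \<open>x\<close> are twinned and one is
      \<open>u\<close>, which leaves at most one in \<open>C\<close>, where the rim asks for
      two.\<close>
    then have "card (N x \<inter> big) = 2"
      using pos[of x] x(2) degree_split[of x] none by simp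
    then have "card (N x \<inter> big - {u}) = 1"
      using \<open>u \<in> N x\<close> u by simp
    moreover have "N x \<inter> C \<subseteq> N x \<inter> big - {u}"
      using C(1) Nu \<open>u \<notin> C\<close> by blast
    ultimately have "card (N x \<inter> C) \<le> 1"
      by (metis card_mono finite_Diff finite_Int finite_N)
    then show ?thesis
      using C(3)[OF x(1)] by simp
  next
    case five
    then show ?thesis
      using tw_neq_4[OF small u] by blast
  next
    case large
    \<comment> \<open>Degree 4 caps the surplus at 6, below the 10 of this case; degree 5 gives at
      least 18 and higher degree at least 15, both above 12.\<close>
    have "card (N u) = 4 \<or> card (N u) = 5 \<or> 6 \<le> card (N u)"
      using degree_big[OF u] by linarith
    then show ?thesis
      using large le[OF u] none surplus_def[of u] by auto
  qed (use none in auto)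
  then have "card big = card twinned"
    using sum_tw by simp
  then have "card V = 2 * card twinned"
    using card_V_split none by simp
  then show ?thesis
    using even_card_twinned by (auto elim!: evenE)
qed

theorem sum_surplus_bounds:
  defines "s \<equiv> (\<Sum>u\<in>V. 12 * int (card (N u)) - 42)"
  shows "0 \<le> s" and "4 dvd card V \<or> 12 < s"
proof -
  show "0 \<le> s"
    unfolding s_def sum_surplus[symmetric] by (rule sum_nonneg) (rule surplus_nonneg)
  show "4 dvd card V \<or> 12 < s"
    unfolding s_def sum_surplus[symmetric]
    using dvd_card_V_if_lonely dvd_card_V_if_no_lonely by (meson all_not_in_conv linorder_not_less)
qed

end

section \<open>From digraphs to neighbourhoods\<close>

lemma cas_nth:
  assumes "pre_digraph.cas H u p v" "i < length p"
  shows "tail H (p ! i) = (if i = 0 then u else head H (p ! (i - 1)))"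
  using assms
proof (induction p arbitrary: u i)
  case (Cons e p)
  then show ?case
    by (cases i; cases "i = 1") (auto simp: pre_digraph.cas.simps nth_Cons')
qed simp

lemma cas_head_last:
  assumes "pre_digraph.cas H u p v" "p \<noteq> []"
  shows "head H (last p) = v"
  using assms by (induction p arbitrary: u) (auto simp: pre_digraph.cas.simps split: if_splits)

text \<open>\<open>C\<close> consists of the heads of the arcs. On a cycle of length at least 3 the
  predecessor and the successor of a vertex differ; \<open>pr\<close> and \<open>su\<close> are the
  cyclic shifts of the index.\<close>

lemma cycle_verts:
  assumes "pre_digraph.cycle H p" "3 \<le> length p"
  obtains C where "C \<noteq> {}"
    "\<forall>x\<in>C. \<exists>y\<in>C. \<exists>z\<in>C. y \<noteq> z \<and> (y, x) \<in> arcs_ends H \<and> (x, z) \<in> arcs_ends H"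
proof -
  define k where "k = length p"
  define d where "d = (\<lambda>i. head H (p ! i))"
  define pr where "pr = (\<lambda>i. if i = 0 then k - 1 else i - 1)"
  define su where "su = (\<lambda>i. if i = k - 1 then 0 else i + 1)"
  obtain u where u: "pre_digraph.awalk H u p u" "distinct (tl (pre_digraph.awalk_verts H u p))"
    using assms(1) by (auto simp: pre_digraph.cycle_def)
  then have cas: "pre_digraph.cas H u p u" and arcs: "set p \<subseteq> arcs H"
    by (auto simp: pre_digraph.awalk_def)
  have "p \<noteq> []" "3 \<le> k"
    using assms(2) by (auto simp: k_def)
  then have "distinct (map (head H) p)"
    using u(2) pre_digraph.awalk_verts_conv'[OF cas] by simp
  then have d_inj: "d i = d j \<Longrightarrow> i = j" if "i < k" "j < k" for i j
    using that by (auto simp: d_def k_def distinct_conv_nth)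
  have arc: "(d (pr i), d i) \<in> arcs_ends H" if "i < k" for i
  proof -
    have "tail H (p ! i) = d (pr i)"
      using cas_nth[OF cas, of i] cas_head_last[OF cas \<open>p \<noteq> []\<close>] that \<open>p \<noteq> []\<close>
      by (auto simp: d_def pr_def k_def last_conv_nth)
    then show ?thesis
      using arcs that by (force simp: arcs_ends_conv d_def k_def)
  qed
  have nbrs: "\<exists>y\<in>d ` {..<k}. \<exists>z\<in>d ` {..<k}. y \<noteq> z \<and> (y, x) \<in> arcs_ends H \<and> (x, z) \<in> arcs_ends H"
    if x: "x \<in> d ` {..<k}" for x
  proof -
    obtain i where i: "i < k" "x = d i"
      using x by auto
    have "su i < k" "pr i < k" "pr (su i) = i" "pr i \<noteq> su i"
      using i \<open>3 \<le> k\<close> by (auto simp: su_def pr_def)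
    then show ?thesis
      using i arc[of i] arc[of "su i"] d_inj[of "pr i" "su i"]
      by (intro bexI[of _ "d (pr i)"] bexI[of _ "d (su i)"]) auto
  qed
  have "d ` {..<k} \<noteq> {}"
    using \<open>3 \<le> k\<close> by (simp add: lessThan_empty_iff)
  then show ?thesis
    by (intro that[of "d ` {..<k}"] ballI nbrs)
qed

lemma arcs_ends_induce_subgraph:
  "arcs_ends (G \<restriction> S) = {(u, v) \<in> arcs_ends G. u \<in> S \<and> v \<in> S}"
  by (auto simp: arcs_ends_conv induce_subgraph_def)

lemma wheel_graph_if_2_connected:
  assumes "pair_graph G" "k_connected 2 (with_proj G)" "locally_nonforesty (with_proj G)"
    and "8 \<le> graph_order (with_proj G)"
  shows "wheel_graph (pverts G) (\<lambda>u. {v. (u, v) \<in> parcs G})"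
proof -
  interpret pair_graph G by fact
  define N where "N = (\<lambda>u. {v. (u, v) \<in> parcs G})"
  have sub: "N u \<subseteq> pverts G" for u
    using in_arcsD2 by (auto simp: N_def)
  have "wheel_graph (pverts G) N"
  proof
    fix u assume "u \<in> pverts G"
    define H where "H = local_subgraph (with_proj G) u"
    have H: "arcs_ends H = {(x, y) \<in> parcs G. x \<in> N u \<and> y \<in> N u}"
      using in_arcsD2
      by (auto simp: H_def local_subgraph_def neighborhood_def arcs_ends_induce_subgraph N_def)
    obtain p where "pre_digraph.cycle H p" "3 \<le> length p"
      using assms(3) \<open>u \<in> pverts G\<close>
      by (auto simp: locally_nonforesty_def contains_cycle_def H_def)
    then obtain C where C: "C \<noteq> {}" "\<forall>x\<in>C. \<exists>y\<in>C. \<exists>z\<in>C. y \<noteq> z \<and> (y, x) \<in> arcs_ends H \<and> (x, z) \<in> arcs_ends H"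
      by (rule cycle_verts)
    have "C \<subseteq> N u"
      using C(2) H by blast
    then have "finite C"
      using sub pair_finite_verts by (metis finite_subset)
    have "2 \<le> card (N x \<inter> C)" if "x \<in> C" for x
    proof -
      obtain y z where "y \<in> C" "z \<in> C" "y \<noteq> z" "(y, x) \<in> parcs G" "(x, z) \<in> parcs G"
        using C(2) \<open>x \<in> C\<close> H by blast
      then have "{y, z} \<subseteq> N x \<inter> C"
        using arcs_symmetric by (auto simp: N_def)
      then have "card {y, z} \<le> card (N x \<inter> C)"
        using \<open>finite C\<close> by (intro card_mono) auto
      then show ?thesis
        using \<open>y \<noteq> z\<close> by simp
    qed
    then show "\<exists>C\<subseteq>N u. C \<noteq> {} \<and> (\<forall>x\<in>C. 2 \<le> card (N x \<inter> C))"
      using C(1) \<open>C \<subseteq> N u\<close> by blast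
  next
    fix S X
    assume S: "S \<subseteq> pverts G" "card S < 2" and X: "X \<subseteq> pverts G - S" "X \<noteq> {}"
      and closed: "\<And>x. x \<in> X \<Longrightarrow> N x \<subseteq> X \<union> S"
    define H where "H = with_proj G \<restriction> (pverts G - S)"
    have "connected H"
      using assms(2) S by (auto simp: k_connected_def H_def)
    obtain x where "x \<in> X"
      using X(2) by blast
    \<comment> \<open>A path from \<open>x\<close> that avoids \<open>S\<close> can never leave
      \<open>X\<close>, by induction along the path.\<close>
    have "y \<in> X" if "y \<in> pverts G - S" for y
    proof -
      have "(x, y) \<in> rtrancl_on (verts H) ((arcs_ends H)\<^sup>s)"
        using \<open>connected H\<close> \<open>x \<in> X\<close> X(1) that by (auto simp: connected_conv H_def)
      then show ?thesis
      proof (induction rule: rtrancl_on_induct)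
        case (step y z)
        then have "z \<in> N y" "z \<notin> S"
          using arcs_symmetric
          by (auto simp: H_def arcs_ends_induce_subgraph N_def symcl_def)
        then show ?case
          using closed[OF step.IH] by blast
      qed (rule \<open>x \<in> X\<close>)
    qed
    then show "X = pverts G - S"
      using X(1) by blast
  qed (use sub arcs_symmetric assms(4) pair_finite_verts
      in \<open>auto simp: N_def graph_order_def dest: no_loops'\<close>)
  then show ?thesis
    by (simp add: N_def)
qed

lemma g_bound_le_graph_size:
  assumes "pair_graph G" "k_connected 2 (with_proj G)" "locally_nonforesty (with_proj G)"
    and "8 \<le> graph_order (with_proj G)"
  shows "g_bound (graph_order (with_proj G)) \<le> graph_size (with_proj G)"
proof -
  interpret pair_graph G by fact
  define N where "N = (\<lambda>u. {v. (u, v) \<in> parcs G})"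
  define n where "n = graph_order (with_proj G)"
  define m where "m = graph_size (with_proj G)"
  interpret W: wheel_graph "pverts G" N
    unfolding N_def using assms by (rule wheel_graph_if_2_connected)
  have n: "card (pverts G) = n"
    by (simp add: n_def graph_order_def)
  have "graph_edges (with_proj G) = {{u, v} |u v. u \<in> pverts G \<and> v \<in> pverts G \<and> v \<in> N u}"
    using in_arcsD1 in_arcsD2 by (fastforce simp: graph_edges_def N_def)
  moreover have "N u \<inter> pverts G = N u" for u
    using W.N_subset by blast
  ultimately have "(\<Sum>u\<in>pverts G. card (N u)) = 2 * m"
    using handshake[of "pverts G" N] W.finite_V W.sym W.irrefl by (simp add: m_def graph_size_def)
  then have "(\<Sum>u\<in>pverts G. 12 * int (card (N u)) - 42) = 24 * int m - 42 * int n"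
    using n by (simp add: sum_subtractf flip: sum_distrib_left of_nat_sum)
  then have "42 * n \<le> 24 * m" "4 dvd n \<or> 42 * n + 12 < 24 * m"
    using W.sum_surplus_bounds unfolding n by auto
  moreover have "n mod 4 = 0 \<or> n mod 4 = 1 \<or> n mod 4 = 2 \<or> n mod 4 = 3"
    by linarith
  moreover have "n = 4 * (n div 4) + n mod 4"
    by simp
  \<comment> \<open>Write \<open>q\<close> for \<open>n div 4\<close>. For residue 0 the weak
    inequality gives \<open>m \<ge> 7 * q\<close>; for residues 1, 2, 3 the strict one gives
    \<open>7 * q + 3\<close>, \<open>7 * q + 5\<close>, \<open>7 * q + 6\<close>. At residue 2
    strictness is essential, since \<open>42 * 2 + 12 = 24 * 4\<close>.\<close>
  ultimately have "g_bound n \<le> m"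
    unfolding g_bound_def dvd_eq_mod_eq_0 by (elim disjE) (simp; linarith)+
  then show ?thesis
    by (simp add: n_def m_def)
qed

section \<open>The extremal graph\<close>

text \<open>
  The condition \<open>n - 4 \<le> u\<close> makes the last four vertices a \<open>K\<^sub>4\<close>, whatever the residue of \<open>n\<close>; the last
  two alternatives form a Hamiltonian cycle, whence 2-connectedness.
\<close>
definition ring_adj :: "nat \<Rightarrow> nat \<Rightarrow> nat \<Rightarrow> bool" where
  "ring_adj n u v \<longleftrightarrow> u < v \<and> v < n \<and>
     (u div 4 = v div 4 \<or> n - 4 \<le> u \<or> v = u + 1 \<or> u = 0 \<and> v = n - 1)"

lemma ring_adj_Suc: "Suc i < n \<Longrightarrow> ring_adj n i (Suc i)"
  by (simp add: ring_adj_def)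

lemma ring_adj_last: "2 \<le> n \<Longrightarrow> ring_adj n 0 (n - 1)"
  by (simp add: ring_adj_def)

definition K4_ring :: "nat \<Rightarrow> nat pair_pre_digraph" where
  "K4_ring n = \<lparr>pverts = {..<n}, parcs = {(u, v). ring_adj n u v \<or> ring_adj n v u}\<rparr>"

lemma K4_ring_simps [simp]:
  "pverts (K4_ring n) = {..<n}"
  "parcs (K4_ring n) = {(u, v). ring_adj n u v \<or> ring_adj n v u}"
  by (simp_all add: K4_ring_def)

lemma pair_graph_K4_ring: "pair_graph (K4_ring n)"
proof
  show "finite (parcs (K4_ring n))"
    by (rule finite_subset[of _ "{..<n} \<times> {..<n}"]) (auto simp: ring_adj_def)
qed (auto simp: ring_adj_def symmetric_def sym_def)

lemma contains_cycle_triangle: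
  assumes "pair_graph G" and "distinct [a, b, c]" "{(a, b), (b, c), (c, a)} \<subseteq> parcs G"
    and "{(v, a), (v, b), (v, c)} \<subseteq> parcs G"
  shows "contains_cycle (local_subgraph (with_proj G) v)"
proof -
  interpret pair_graph G by fact
  let ?H = "local_subgraph (with_proj G) v"
  have "{a, b, c} \<subseteq> neighborhood (with_proj G) v"
    using assms(4) in_arcsD2 by (auto simp: neighborhood_def)
  then have "pre_digraph.awalk ?H a [(a, b), (b, c), (c, a)] a"
    using assms(3)
    by (auto simp: pre_digraph.awalk_def pre_digraph.cas.simps local_subgraph_def induce_subgraph_def)
  moreover have "pre_digraph.awalk_verts ?H a [(a, b), (b, c), (c, a)] = [a, b, c, a]"
    by (simp add: pre_digraph.awalk_verts.simps local_subgraph_def induce_subgraph_def)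
  ultimately have "pre_digraph.cycle ?H [(a, b), (b, c), (c, a)]"
    using assms(2) by (auto simp: pre_digraph.cycle_def)
  then show ?thesis
    unfolding contains_cycle_def by (intro exI[of _ "[(a, b), (b, c), (c, a)]"]) simp
qed

section \<open>Local cycles and 2-connectedness of the ring\<close>

lemma locally_nonforesty_K4_ring:
  assumes "4 \<le> n"
  shows "locally_nonforesty (with_proj (K4_ring n))"
  unfolding locally_nonforesty_def
proof
  fix v assume "v \<in> verts (with_proj (K4_ring n))"
  then have "v < n"
    by simp
  \<comment> \<open>The four vertices from \<open>s\<close> on form a K4 containing
    \<open>v\<close>: the block of \<open>v\<close>, or the last four vertices if \<open>v\<close>
    lies beyond the last full block.\<close>
  define s where "s = (if v < 4 * (n div 4) then 4 * (v div 4) else n - 4)"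
  have s: "s \<le> v" "v < s + 4" "s + 4 \<le> n"
  proof -
    have "4 * (n div 4) + n mod 4 = n" "n mod 4 < 4" "4 * (v div 4) + v mod 4 = v" "v mod 4 < 4"
      by simp_all
    moreover have "v div 4 < n div 4" if "v < 4 * (n div 4)"
      using that by (simp add: less_mult_imp_div_less mult.commute)
    ultimately show "s \<le> v" "v < s + 4" "s + 4 \<le> n"
      using \<open>v < n\<close> assms unfolding s_def by (simp_all split: if_split) linarith+
  qed
  have adj: "ring_adj n x y" if "s \<le> x" "x < y" "y < s + 4" for x y
  proof (cases "v < 4 * (n div 4)")
    case True
    then have "x div 4 = v div 4" "y div 4 = v div 4"
      using that by (auto simp: s_def)
    moreover have "y < n"
      using that s by linarith
    ultimately show ?thesis
      using that(2) by (simp add: ring_adj_def)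
  next
    case False
    then have "n - 4 \<le> x"
      using that(1) by (simp add: s_def)
    moreover have "y < n"
      using that s by linarith
    ultimately show ?thesis
      using that(2) by (simp add: ring_adj_def)
  qed
  have ex: "contains_cycle (local_subgraph (with_proj (K4_ring n)) v)"
    if "distinct [a, b, c, v]" "{a, b, c} \<subseteq> {s..<s + 4}" for a b c
  proof (rule contains_cycle_triangle[OF pair_graph_K4_ring])
    have *: "(x, y) \<in> parcs (K4_ring n)" if "x \<in> {s..<s + 4}" "y \<in> {s..<s + 4}" "x \<noteq> y" for x y
      using that adj[of x y] adj[of y x] by (cases x y rule: linorder_cases) auto
    show "{(a, b), (b, c), (c, a)} \<subseteq> parcs (K4_ring n)" "{(v, a), (v, b), (v, c)} \<subseteq> parcs (K4_ring n)"
      using that s(1,2) by (auto intro!: * simp del: K4_ring_simps)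
  qed (use that in auto)
  consider "v = s" | "v = s + 1" | "v = s + 2" | "v = s + 3"
    using s(1,2) by force
  then show "contains_cycle (local_subgraph (with_proj (K4_ring n)) v)"
  proof cases
    case 1 then show ?thesis by (intro ex[of "s + 1" "s + 2" "s + 3"]) auto
  next
    case 2 then show ?thesis by (intro ex[of s "s + 2" "s + 3"]) auto
  next
    case 3 then show ?thesis by (intro ex[of s "s + 1" "s + 3"]) auto
  next
    case 4 then show ?thesis by (intro ex[of s "s + 1" "s + 2"]) auto
  qed
qed

lemma connected_if_spanning_path:
  assumes "f ` {..<m} = verts H" "0 < m"
    and "\<And>i. Suc i < m \<Longrightarrow> (f i, f (Suc i)) \<in> arcs_ends H"
  shows "connected H"
proof -
  define R where "R = rtrancl_on (verts H) ((arcs_ends H)\<^sup>s)"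
  have "(f 0, f i) \<in> R" if "i < m" for i
    using that
  proof (induction i)
    case 0
    then show ?case
      using assms(1) by (auto simp: R_def)
  next
    case (Suc i)
    then have "(f 0, f i) \<in> R" "(f i, f (Suc i)) \<in> (arcs_ends H)\<^sup>s" "f (Suc i) \<in> verts H"
      using assms by (auto simp: symcl_def)
    then show ?case
      unfolding R_def by (rule rtrancl_on_into_rtrancl_on)
  qed
  then have from0: "(f 0, v) \<in> R" if "v \<in> verts H" for v
    using that unfolding assms(1)[symmetric] by blast
  have "sym R"
    unfolding R_def by (rule rtrancl_on_sym) (auto simp: symcl_def sym_def)
  then have "(u, v) \<in> R" if "u \<in> verts H" "v \<in> verts H" for u v
    using from0[OF that(1)] from0[OF that(2)] unfolding R_def
    by (meson rtrancl_on_trans symE)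
  then show ?thesis
    using assms(1,2) by (auto simp: connected_conv R_def)
qed

lemma k_connected_K4_ring:
  assumes "3 \<le> n"
  shows "k_connected 2 (with_proj (K4_ring n))"
  unfolding k_connected_def
proof (intro conjI allI impI)
  show "2 < graph_order (with_proj (K4_ring n))"
    using assms by (simp add: graph_order_def)
next
  fix S assume "S \<subseteq> verts (with_proj (K4_ring n))" and S: "card S < 2"
  then have "S \<subseteq> {..<n}"
    by simp
  then have "finite S"
    by (rule finite_subset) simp
  then consider "S = {}" | s where "S = {s}"
    using S less_2_cases[of "card S"] by (auto simp: card_1_singleton_iff)
  then show "connected (with_proj (K4_ring n) \<restriction> (verts (with_proj (K4_ring n)) - S))"
  proof cases
    case 1
    then show ?thesis
      using assms
      by (intro connected_if_spanning_path[of "\<lambda>i. i" n])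
        (auto simp: arcs_ends_induce_subgraph ring_adj_Suc)
  next
    case (2 s)
    then have "s < n"
      using \<open>S \<subseteq> {..<n}\<close> by auto
    \<comment> \<open>This is \<open>s + 1 + i\<close> modulo \<open>n\<close>: without
      \<open>s\<close>, the Hamiltonian cycle is a path that starts just after
      \<open>s\<close>.\<close>
    define f where "f = (\<lambda>i. if s + 1 + i < n then s + 1 + i else s + 1 + i - n)"
    show ?thesis
    proof (rule connected_if_spanning_path[of f "n - 1"])
      have "x \<in> f ` {..<n - 1}" if "x < n" "x \<noteq> s" for x
      proof (rule image_eqI)
        show "x = f (if s < x then x - s - 1 else x + n - s - 1)"
          using that \<open>s < n\<close> by (cases "s < x") (auto simp: f_def)
      qed (use that \<open>s < n\<close> in auto)
      then show "f ` {..<n - 1} = verts (with_proj (K4_ring n) \<restriction> (verts (with_proj (K4_ring n)) - S))"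
        using \<open>s < n\<close> 2 by (auto simp: f_def)
    next
      fix i assume "Suc i < n - 1"
      then have "f i < n - 1 \<and> f (Suc i) = Suc (f i) \<or> f i = n - 1 \<and> f (Suc i) = 0"
        using \<open>s < n\<close> by (auto simp: f_def)
      then have "ring_adj n (f i) (f (Suc i)) \<or> ring_adj n (f (Suc i)) (f i)"
        using ring_adj_Suc[of "f i" n] ring_adj_last[of n] assms by auto
      moreover have "f i \<noteq> s" "f (Suc i) \<noteq> s" "f i < n" "f (Suc i) < n"
        using \<open>Suc i < n - 1\<close> \<open>s < n\<close> by (auto simp: f_def)
      ultimately show "(f i, f (Suc i)) \<in>
          arcs_ends (with_proj (K4_ring n) \<restriction> (verts (with_proj (K4_ring n)) - S))"
        using 2 by (auto simp: arcs_ends_induce_subgraph)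
    qed (use assms in simp)
  qed
qed

section \<open>The number of edges of the ring\<close>

lemma sum_ring_back_degrees:
  "(\<Sum>v<4 * Suc k. if v mod 4 = 0 \<and> 0 < v then 1 else v mod 4) = 7 * k + 6"
proof -
  \<comment> \<open>The number of edges from \<open>v\<close> to earlier vertices within the full
    blocks: \<open>v mod 4\<close> in its own block, or the single link to the preceding block. The
    first block yields 6, every later one 7.\<close>
  define f :: "nat \<Rightarrow> nat" where "f = (\<lambda>v. if v mod 4 = 0 \<and> 0 < v then 1 else v mod 4)"
  have step: "sum f {..<4 * Suc i} = sum f {..<4 * i} + f (4 * i) + 6" for i
  proof -
    have "f (Suc (4 * i)) = 1" "f (Suc (Suc (4 * i))) = 2" "f (Suc (Suc (Suc (4 * i)))) = 3"
      by (simp_all add: f_def mod_Suc)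
    moreover have "4 * Suc i = Suc (Suc (Suc (Suc (4 * i))))"
      by simp
    ultimately show ?thesis
      by (simp del: mult_Suc_right)
  qed
  have "sum f {..<4 * Suc k} = 7 * k + 6"
  proof (induction k)
    case 0
    show ?case
      unfolding step by (simp add: f_def)
  next
    case (Suc k)
    have "f (4 * Suc k) = 1"
      unfolding f_def by (simp del: mult_Suc_right)
    then show ?case
      unfolding step[of "Suc k"] Suc.IH by simp
  qed
  then show ?thesis
    by (simp only: f_def)
qed

text \<open>Edges are sorted by their larger end \<open>v\<close>: \<open>E1\<close> has
  \<open>v\<close> in a full block, \<open>E2\<close> has \<open>v\<close> among the leftover
  vertices, and the edge \<open>{0, n - 1}\<close> closes the ring. An upper bound suffices, as the
  general lower bound applies to the ring too.\<close>

lemma graph_size_K4_ring: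
  assumes "4 \<le> n"
  shows "graph_size (with_proj (K4_ring n)) \<le> g_bound n"
proof -
  define k where "k = n div 4"
  \<comment> \<open>The predecessor \<open>v - 1\<close> adds something only at the start of a
    block. The vertex 0 is set apart because \<open>0 - 1 = 0\<close> would create a loop.\<close>
  define A where "A = (\<lambda>v :: nat. {4 * (v div 4)..<v} \<union> (if v = 0 then {} else {v - 1}))"
  define E1 where "E1 = (\<Union>v<4 * k. (\<lambda>u. {u, v}) ` A v)"
  define E2 where "E2 = (\<Union>v\<in>{4 * k..<n}. (\<lambda>u. {u, v}) ` {n - 4..<v})"
  have edge: "{u, v} \<in> insert {0, n - 1} (E1 \<union> E2)" if "ring_adj n u v" for u v
  proof -
    have uv: "u < v" "v < n"
      "u div 4 = v div 4 \<or> n - 4 \<le> u \<or> v = u + 1 \<or> u = 0 \<and> v = n - 1"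
      using that by (simp_all add: ring_adj_def)
    show ?thesis
    proof (cases "v < 4 * k")
      case True
      then have "v div 4 < k"
        by (simp add: less_mult_imp_div_less mult.commute)
      moreover have "4 * k \<le> n"
        by (simp add: k_def)
      ultimately have "4 * (v div 4) \<le> n - 4"
        by linarith
      moreover have "4 * (u div 4) \<le> u"
        by simp
      ultimately have "4 * (v div 4) \<le> u \<or> u = v - 1 \<or> u = 0 \<and> v = n - 1"
        using uv(3) by (elim disjE) auto
      then have "u \<in> A v \<or> u = 0 \<and> v = n - 1"
        using uv(1) by (auto simp: A_def)
      then show ?thesis
        using True by (auto simp: E1_def)
    next
      case False
      then have "k \<le> v div 4"
        by simp
      moreover have "4 * k + n mod 4 = n" "n mod 4 < 4" "u mod 4 < 4" "4 * (u div 4) + u mod 4 = u"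
        by (simp_all add: k_def)
      \<comment> \<open>At most three vertices are left over, so \<open>4 * k - 1\<close>, the least
        possible predecessor of \<open>v\<close>, is still at least \<open>n - 4\<close>.\<close>
      ultimately have "n - 4 \<le> u \<or> u = 0 \<and> v = n - 1"
        using uv(3) False by (elim disjE) linarith+
      then show ?thesis
      proof
        assume "n - 4 \<le> u"
        then have "{u, v} \<in> E2"
          unfolding E2_def using uv False by (intro UN_I[of v] imageI) auto
        then show ?thesis
          by blast
      qed simp
    qed
  qed
  have "graph_edges (with_proj (K4_ring n)) \<subseteq> insert {0, n - 1} (E1 \<union> E2)"
  proof
    fix e assume "e \<in> graph_edges (with_proj (K4_ring n))"
    then obtain u v where "e = {u, v}" "ring_adj n u v \<or> ring_adj n v u"
      unfolding graph_edges_def with_proj_simps K4_ring_simps by blast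
    then show "e \<in> insert {0, n - 1} (E1 \<union> E2)"
      using edge[of u v] edge[of v u] insert_commute[of u v "{}"] by argo
  qed
  moreover have fin: "finite (E1 \<union> E2)"
    by (auto simp: E1_def E2_def A_def)
  ultimately have "graph_size (with_proj (K4_ring n)) \<le> card (insert {0, n - 1} (E1 \<union> E2))"
    unfolding graph_size_def by (intro card_mono) auto
  also have "\<dots> \<le> Suc (card (E1 \<union> E2))"
    using fin by (simp add: card_insert_if)
  also have "\<dots> \<le> Suc (card E1 + card E2)"
    using card_Un_le[of E1 E2] by simp
  finally have size: "graph_size (with_proj (K4_ring n)) \<le> Suc (card E1 + card E2)" .
  have "card E1 \<le> 7 * k - 1"
  proof -
    have "card (A v) = (if v mod 4 = 0 \<and> 0 < v then 1 else v mod 4)" for v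
    proof (cases "v mod 4 = 0")
      case True
      then have "4 * (v div 4) = v"
        by presburger
      then show ?thesis
        using True by (simp add: A_def)
    next
      case False
      then have "A v = {4 * (v div 4)..<v}"
        by (auto simp: A_def) presburger+
      then show ?thesis
        using False by (simp add: minus_mult_div_eq_mod)
    qed
    then have A: "card ((\<lambda>u. {u, v}) ` A v) \<le> (if v mod 4 = 0 \<and> 0 < v then 1 else v mod 4)" for v
      using card_image_le[of "A v" "\<lambda>u. {u, v}"] by (simp add: A_def)
    have "card E1 \<le> (\<Sum>v<4 * k. card ((\<lambda>u. {u, v}) ` A v))"
      unfolding E1_def by (rule card_UN_le) simp
    also have "\<dots> \<le> (\<Sum>v<4 * k. if v mod 4 = 0 \<and> 0 < v then 1 else v mod 4)"
      by (intro sum_mono A)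
    also have "\<dots> = 7 * k - 1"
    proof -
      obtain j where "k = Suc j"
        using assms by (cases k) (auto simp: k_def)
      then show ?thesis
        using sum_ring_back_degrees[of j] by simp
    qed
    finally show ?thesis .
  qed
  moreover have "card E2 \<le> (\<Sum>v = 4 * k..<n. v - (n - 4))"
  proof -
    have "card E2 \<le> (\<Sum>v = 4 * k..<n. card ((\<lambda>u. {u, v}) ` {n - 4..<v}))"
      unfolding E2_def by (rule card_UN_le) simp
    also have "\<dots> \<le> (\<Sum>v = 4 * k..<n. v - (n - 4))"
      by (intro sum_mono order.trans[OF card_image_le]) auto
    finally show ?thesis .
  qed
  moreover have "7 * k + (\<Sum>v = 4 * k..<n. v - (n - 4)) = g_bound n"
  proof -
    define r where "r = n mod 4"
    have r: "r = 0 \<or> r = 1 \<or> r = 2 \<or> r = 3"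
      unfolding r_def by linarith
    have n: "n = 4 * k + r"
      by (simp add: k_def r_def)
    have "g_bound n = (if r = 0 \<or> r = 3 then 2 * (4 * k + r) - k else 2 * (4 * k + r) + 1 - k)"
      unfolding g_bound_def r_def[symmetric] k_def[symmetric] by (simp add: n)
    moreover have "0 < k"
      using assms by (simp add: k_def)
    \<comment> \<open>For the residues 0, 1, 2, 3 the sum is 0, 3, \<open>2 + 3\<close> and
      \<open>1 + 2 + 3\<close>.\<close>
    ultimately show ?thesis
      using r unfolding n by (elim disjE) (simp_all add: eval_nat_numeral)
  qed
  moreover have "0 < k"
    using assms by (simp add: k_def)
  ultimately show ?thesis
    using size by linarith
qed

theorem theorem3:
  fixes n :: nat
  assumes "n \<ge> 8"
  shows "(\<forall>G :: 'a pair_pre_digraph.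
            pair_graph G \<and> k_connected 2 (with_proj G) \<and> locally_nonforesty (with_proj G) \<and>
            graph_order (with_proj G) = n \<longrightarrow> g_bound n \<le> graph_size (with_proj G))
       \<and> (\<exists>G :: nat pair_pre_digraph.
            pair_graph G \<and> k_connected 2 (with_proj G) \<and> locally_nonforesty (with_proj G) \<and>
            graph_order (with_proj G) = n \<and> graph_size (with_proj G) = g_bound n)"
proof (intro conjI exI[of _ "K4_ring n"] allI impI)
  have K: "pair_graph (K4_ring n)" "k_connected 2 (with_proj (K4_ring n))"
    "locally_nonforesty (with_proj (K4_ring n))" "graph_order (with_proj (K4_ring n)) = n"
    using assms pair_graph_K4_ring k_connected_K4_ring locally_nonforesty_K4_ring
    by (auto simp: graph_order_def)
  then show "pair_graph (K4_ring n)" "k_connected 2 (with_proj (K4_ring n))"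
    "locally_nonforesty (with_proj (K4_ring n))" "graph_order (with_proj (K4_ring n)) = n"
    by auto
  \<comment> \<open>The lower bound, applied to the ring itself, turns the upper bound on its size
    into an equality.\<close>
  show "graph_size (with_proj (K4_ring n)) = g_bound n"
    using g_bound_le_graph_size[of "K4_ring n"] graph_size_K4_ring[of n] K assms by simp
qed (use assms g_bound_le_graph_size in auto)

end
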